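(* Let $\mathcal{QT}$ be the category whose objects are the Quantum Tori $Z_L$ ($L$ a pseudolattice) and whose morphisms $Z_L\to Z_M$ are the maps $f:Z_L\to Z_M$ for which there exists a morphism $\tilde f:T_L\to T_M$ of Hyper Quantum Tori with $p_M\circ\tilde f=f\circ p_L$. Let $\mathcal{PL}$ be the category of pseudolattices. Then the categories $\mathcal{QT}$ and $\mathcal{PL}$ are equivalent.
   Context: Fix a nonstandard model ${}^*:V(\mathbb{R})\to V({}^*\mathbb{R})$ of the superstructure over $\mathbb{R}$ (satisfying the transfer principle and saturation). A set is internal if it is an element of ${}^*B$ for some $B\in V(\mathbb{R})$. ${}^*\mathbb{R}^{\mathrm{nst}}$ denotes the set of near-standard (limited) elements of ${}^*\mathbb{R}$, i.e. those infinitely close to some real number, and $\mathrm{st}:{}^*\mathbb{R}^{\mathrm{nst}}\to\mathbb{R}$ is the standard part map. A pseudolattice is a dense additive subgroup $L\subseteq\mathbb{R}$ of rank two. The category $\mathcal{PL}$ has pseudolattices as objects, and a morphism $L_1\to L_2$ is a positive real number $\beta$ with $\beta L_1\subseteq L_2$. The Quantum Torus of $L$ is $Z_L=\mathbb{R}/L$ with the quotient topology. The Hyper Quantum Torus of $L$ is $T_L={}^*\mathbb{R}^{\mathrm{nst}}/L$, with projection $\pi_L:{}^*\mathbb{R}^{\mathrm{nst}}\to T_L$, and $p_L:T_L\to Z_L$ is the map $\pi_L(x)\mapsto \mathrm{st}(x)+L$. A morphism of Hyper Quantum Tori $T_L\to T_M$ is the map $x+L\mapsto\phi(x)+M$ induced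 by an internal additive homomorphism $\phi:{}^*\mathbb{R}\to{}^*\mathbb{R}$ (the universal internal covering space) which maps ${}^*\mathbb{R}^{\mathrm{nst}}$ into ${}^*\mathbb{R}^{\mathrm{nst}}$ and satisfies $\phi(r)+M=\phi(r+L)$ for all $r\in{}^*\mathbb{R}^{\mathrm{nst}}$.
   Formalization: As stated the claim fails: x↦−x gives each Z_L an order-two automorphism, absent in PL. Proved instead: QT is equivalent to PL with any real β (βL⊆M) allowed, and PL to QT restricted to φ positive on positive elements; φ(r)+M=φ(r+L) is read modulo M. *)

theory Defs
  imports "HOL-Analysis.Analysis"
begin

section \<open>Superstructures and nonstandard models\<close>

text \<open>The superstructure over a set of individuals has no HOL type of its own, so it is described
  up to isomorphism: a type 'u with individuals \<open>atom\<close> and a membership relation \<open>mem\<close>.\<close>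

record ('a, 'u) superstr =
  atom :: "'a \<Rightarrow> 'u"
  mem :: "'u \<Rightarrow> 'u \<Rightarrow> bool"

definition elems :: "('a, 'u) superstr \<Rightarrow> 'u \<Rightarrow> 'u set" where
  "elems S u = {x. mem S x u}"

abbreviation atoms :: "('a, 'u) superstr \<Rightarrow> 'u set" where
  "atoms S \<equiv> range (atom S)"

text \<open>\<open>V\<^sub>0 = X\<close> and \<open>V\<^sub>n\<^sub>+\<^sub>1 = V\<^sub>n \<union> \<P>(V\<^sub>n)\<close>.\<close>

primrec level :: "('a, 'u) superstr \<Rightarrow> nat \<Rightarrow> 'u set" where
  "level S 0 = atoms S"
| "level S (Suc n) = level S n \<union> {u. u \<notin> atoms S \<and> elems S u \<subseteq> level S n}"

definition superstructure :: "('a, 'u) superstr \<Rightarrow> bool" where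
  "superstructure S \<longleftrightarrow>
     inj (atom S) \<and>
     (\<forall>a. elems S (atom S a) = {}) \<and>
     (\<forall>u v. u \<notin> atoms S \<longrightarrow> v \<notin> atoms S \<longrightarrow> elems S u = elems S v \<longrightarrow> u = v) \<and>
     (\<forall>n. \<forall>X \<subseteq> level S n. \<exists>u. u \<notin> atoms S \<and> elems S u = X) \<and>
     (\<forall>u. \<exists>n. u \<in> level S n)"

text \<open>The element of the superstructure that represents the set \<open>X\<close>
  (which must be a subset of some \<open>level\<close>).\<close>

definition set_of :: "('a, 'u) superstr \<Rightarrow> 'u set \<Rightarrow> 'u" where
  "set_of S X = (THE u. u \<notin> atoms S \<and> elems S u = X)"

definition kpair :: "('a, 'u) superstr \<Rightarrow> 'u \<Rightarrow> 'u \<Rightarrow> 'u" where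
  "kpair S x y = set_of S {set_of S {x}, set_of S {x, y}}"

definition fun_graph :: "('a, 'u) superstr \<Rightarrow> ('a \<Rightarrow> 'a) \<Rightarrow> 'u" where
  "fun_graph S f = set_of S {kpair S (atom S x) (atom S (f x)) | x. True}"

definition op_graph :: "('a, 'u) superstr \<Rightarrow> ('a \<Rightarrow> 'a \<Rightarrow> 'a) \<Rightarrow> 'u" where
  "op_graph S f = set_of S {kpair S (kpair S (atom S x) (atom S y)) (atom S (f x y)) | x y. True}"

definition rel_graph :: "('a, 'u) superstr \<Rightarrow> ('a \<Rightarrow> 'a \<Rightarrow> bool) \<Rightarrow> 'u" where
  "rel_graph S R = set_of S {kpair S (atom S x) (atom S y) | x y. R x y}"

text \<open>Bounded formulas of the language of set theory, with named variables;
  \<open>BAll x y p\<close> is \<open>\<forall>x \<in> y. p\<close>.\<close>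

datatype bfm =
    Mem nat nat
  | Eq nat nat
  | Neg bfm
  | Conj bfm bfm
  | BAll nat nat bfm

primrec sat :: "('a, 'u) superstr \<Rightarrow> (nat \<Rightarrow> 'u) \<Rightarrow> bfm \<Rightarrow> bool" where
  "sat S e (Mem x y) = mem S (e x) (e y)"
| "sat S e (Eq x y) = (e x = e y)"
| "sat S e (Neg p) = (\<not> sat S e p)"
| "sat S e (Conj p q) = (sat S e p \<and> sat S e q)"
| "sat S e (BAll x y p) = (\<forall>a. mem S a (e y) \<longrightarrow> sat S (e(x := a)) p)"

record ('u, 'h, 'v) ns_model =
  VR :: "(real, 'u) superstr"
  VH :: "('h, 'v) superstr"
  star :: "'u \<Rightarrow> 'v"

definition internal :: "('u, 'h, 'v) ns_model \<Rightarrow> 'v \<Rightarrow> bool" where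
  "internal N u \<longleftrightarrow> (\<exists>B. mem (VH N) u (star N B))"

definition transfer_principle :: "('u, 'h, 'v) ns_model \<Rightarrow> bool" where
  "transfer_principle N \<longleftrightarrow> (\<forall>p e. sat (VR N) e p \<longleftrightarrow> sat (VH N) (star N \<circ> e) p)"

text \<open>Countable saturation; every stronger degree of saturation implies it.\<close>

definition saturated :: "('u, 'h, 'v) ns_model \<Rightarrow> bool" where
  "saturated N \<longleftrightarrow>
     (\<forall>A :: nat \<Rightarrow> 'v. (\<forall>n. internal N (A n)) \<longrightarrow>
        (\<forall>n. (\<Inter>i\<le>n. elems (VH N) (A i)) \<noteq> {}) \<longrightarrow>
        (\<Inter>i. elems (VH N) (A i)) \<noteq> {})"

text \<open>The type 'h is the set of hyperreals. Its ordered field structure is required to be the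
  star-extension of the ordered field structure of the reals.\<close>

definition nonstandard_model :: "('u, 'h::linordered_field, 'v) ns_model \<Rightarrow> bool" where
  "nonstandard_model N \<longleftrightarrow>
     superstructure (VR N) \<and> superstructure (VH N) \<and>
     star N (set_of (VR N) (atoms (VR N))) = set_of (VH N) (atoms (VH N)) \<and>
     star N (op_graph (VR N) (+)) = op_graph (VH N) (+) \<and>
     star N (op_graph (VR N) (*)) = op_graph (VH N) (*) \<and>
     star N (rel_graph (VR N) (<)) = rel_graph (VH N) (<) \<and>
     transfer_principle N \<and> saturated N"

definition internal_fun :: "('u, 'h, 'v) ns_model \<Rightarrow> ('h \<Rightarrow> 'h) \<Rightarrow> bool" where
  "internal_fun N f \<longleftrightarrow> internal N (fun_graph (VH N) f)"

definition hyper :: "('u, 'h, 'v) ns_model \<Rightarrow> real \<Rightarrow> 'h" where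
  "hyper N r = (THE h. star N (atom (VR N) r) = atom (VH N) h)"

definition inf_close :: "('u, 'h::linordered_field, 'v) ns_model \<Rightarrow> 'h \<Rightarrow> 'h \<Rightarrow> bool" where
  "inf_close N x y \<longleftrightarrow> (\<forall>e::real. e > 0 \<longrightarrow> \<bar>x - y\<bar> < hyper N e)"

definition nst :: "('u, 'h::linordered_field, 'v) ns_model \<Rightarrow> 'h set" where
  "nst N = {x. \<exists>r. inf_close N x (hyper N r)}"

definition st :: "('u, 'h::linordered_field, 'v) ns_model \<Rightarrow> 'h \<Rightarrow> real" where
  "st N x = (THE r. inf_close N x (hyper N r))"


section \<open>Categories\<close>

text \<open>\<open>Comp C a b c g f\<close> is the composite of \<open>f : a \<rightarrow> b\<close> and \<open>g : b \<rightarrow> c\<close>.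
  Hom-sets of different pairs of objects need not be disjoint.\<close>

record ('o, 'm) cat =
  Obj :: "'o set"
  Hom :: "'o \<Rightarrow> 'o \<Rightarrow> 'm set"
  Ident :: "'o \<Rightarrow> 'm"
  Comp :: "'o \<Rightarrow> 'o \<Rightarrow> 'o \<Rightarrow> 'm \<Rightarrow> 'm \<Rightarrow> 'm"

definition category :: "('o, 'm) cat \<Rightarrow> bool" where
  "category C \<longleftrightarrow>
     (\<forall>a\<in>Obj C. Ident C a \<in> Hom C a a) \<and>
     (\<forall>a\<in>Obj C. \<forall>b\<in>Obj C. \<forall>c\<in>Obj C. \<forall>f\<in>Hom C a b. \<forall>g\<in>Hom C b c.
        Comp C a b c g f \<in> Hom C a c) \<and>
     (\<forall>a\<in>Obj C. \<forall>b\<in>Obj C. \<forall>f\<in>Hom C a b.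
        Comp C a a b f (Ident C a) = f \<and> Comp C a b b (Ident C b) f = f) \<and>
     (\<forall>a\<in>Obj C. \<forall>b\<in>Obj C. \<forall>c\<in>Obj C. \<forall>d\<in>Obj C.
        \<forall>f\<in>Hom C a b. \<forall>g\<in>Hom C b c. \<forall>h\<in>Hom C c d.
        Comp C a c d h (Comp C a b c g f) = Comp C a b d (Comp C b c d h g) f)"

text \<open>A functor is given by its action on objects and its action on each hom-set.\<close>

type_synonym ('o, 'm, 'p, 'n) fnctr = "('o \<Rightarrow> 'p) \<times> ('o \<Rightarrow> 'o \<Rightarrow> 'm \<Rightarrow> 'n)"

definition is_functor :: "('o, 'm) cat \<Rightarrow> ('p, 'n) cat \<Rightarrow> ('o, 'm, 'p, 'n) fnctr \<Rightarrow> bool" where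
  "is_functor C D F \<longleftrightarrow>
     (\<forall>a\<in>Obj C. fst F a \<in> Obj D) \<and>
     (\<forall>a\<in>Obj C. \<forall>b\<in>Obj C. \<forall>f\<in>Hom C a b. snd F a b f \<in> Hom D (fst F a) (fst F b)) \<and>
     (\<forall>a\<in>Obj C. snd F a a (Ident C a) = Ident D (fst F a)) \<and>
     (\<forall>a\<in>Obj C. \<forall>b\<in>Obj C. \<forall>c\<in>Obj C. \<forall>f\<in>Hom C a b. \<forall>g\<in>Hom C b c.
        snd F a c (Comp C a b c g f) =
        Comp D (fst F a) (fst F b) (fst F c) (snd F b c g) (snd F a b f))"

definition id_functor :: "('o, 'm, 'o, 'm) fnctr" where
  "id_functor = (\<lambda>a. a, \<lambda>a b f. f)"

definition comp_functor ::
  "('p, 'n, 'q, 'k) fnctr \<Rightarrow> ('o, 'm, 'p, 'n) fnctr \<Rightarrow> ('o, 'm, 'q, 'k) fnctr" where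
  "comp_functor G F = (\<lambda>a. fst G (fst F a), \<lambda>a b f. snd G (fst F a) (fst F b) (snd F a b f))"

definition is_iso :: "('o, 'm) cat \<Rightarrow> 'o \<Rightarrow> 'o \<Rightarrow> 'm \<Rightarrow> bool" where
  "is_iso C a b f \<longleftrightarrow> f \<in> Hom C a b \<and>
     (\<exists>g\<in>Hom C b a. Comp C a b a g f = Ident C a \<and> Comp C b a b f g = Ident C b)"

definition nat_iso :: "('o, 'm) cat \<Rightarrow> ('p, 'n) cat \<Rightarrow>
    ('o, 'm, 'p, 'n) fnctr \<Rightarrow> ('o, 'm, 'p, 'n) fnctr \<Rightarrow> ('o \<Rightarrow> 'n) \<Rightarrow> bool" where
  "nat_iso C D F G \<eta> \<longleftrightarrow>
     (\<forall>a\<in>Obj C. is_iso D (fst F a) (fst G a) (\<eta> a)) \<and>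
     (\<forall>a\<in>Obj C. \<forall>b\<in>Obj C. \<forall>f\<in>Hom C a b.
        Comp D (fst F a) (fst F b) (fst G b) (\<eta> b) (snd F a b f) =
        Comp D (fst F a) (fst G a) (fst G b) (snd G a b f) (\<eta> a))"

definition equivalent_categories :: "('o, 'm) cat \<Rightarrow> ('p, 'n) cat \<Rightarrow> bool" where
  "equivalent_categories C D \<longleftrightarrow> category C \<and> category D \<and>
     (\<exists>F G \<eta> \<epsilon>. is_functor C D F \<and> is_functor D C G \<and>
        nat_iso C C id_functor (comp_functor G F) \<eta> \<and>
        nat_iso D D (comp_functor F G) id_functor \<epsilon>)"


section \<open>Pseudolattices\<close>

text \<open>``Rank two'' means free of rank two, as for lattices.\<close>

definition pseudolattice :: "real set \<Rightarrow> bool" where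
  "pseudolattice L \<longleftrightarrow>
     0 \<in> L \<and> (\<forall>x\<in>L. \<forall>y\<in>L. x - y \<in> L) \<and>
     closure L = UNIV \<and>
     (\<exists>a b :: real. (\<forall>m n :: int. of_int m * a + of_int n * b = 0 \<longrightarrow> m = 0 \<and> n = 0) \<and>
        L = {of_int m * a + of_int n * b | m n :: int. True})"

definition multiplier_cat :: "real set \<Rightarrow> (real set, real) cat" where
  "multiplier_cat R = \<lparr>
     Obj = {L. pseudolattice L},
     Hom = (\<lambda>L M. {\<beta> \<in> R. (\<lambda>l. \<beta> * l) ` L \<subseteq> M}),
     Ident = (\<lambda>L. 1),
     Comp = (\<lambda>L M K \<gamma> \<beta>. \<gamma> * \<beta>)\<rparr>"

definition PL :: "(real set, real) cat" where
  "PL = multiplier_cat {0<..}"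

definition PL_signed :: "(real set, real) cat" where
  "PL_signed = multiplier_cat UNIV"


section \<open>Quantum tori and hyper quantum tori\<close>

definition proj :: "real set \<Rightarrow> real \<Rightarrow> real set" where
  "proj L x = (\<lambda>l. x + l) ` L"

definition quantum_torus :: "real set \<Rightarrow> real set topology" where
  "quantum_torus L = topology (\<lambda>U. U \<subseteq> range (proj L) \<and> open (proj L -` U))"

definition hproj :: "('u, 'h::linordered_field, 'v) ns_model \<Rightarrow> real set \<Rightarrow> 'h \<Rightarrow> 'h set" where
  "hproj N L x = (\<lambda>l. x + hyper N l) ` L"

definition hyper_torus :: "('u, 'h::linordered_field, 'v) ns_model \<Rightarrow> real set \<Rightarrow> 'h set set" where
  "hyper_torus N L = hproj N L ` nst N"

definition to_quantum ::
    "('u, 'h::linordered_field, 'v) ns_model \<Rightarrow> real set \<Rightarrow> 'h set \<Rightarrow> real set" where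
  "to_quantum N L t = (THE z. \<exists>x\<in>nst N. t = hproj N L x \<and> z = proj L (st N x))"

text \<open>The condition \<open>\<phi>(r + L) = \<phi>(r) + M\<close> is read in the quotient modulo \<open>M\<close>: all of \<open>r + L\<close> is
  sent to the class \<open>\<phi>(r) + M\<close>. (An equality of subsets of the hyperreals would say
  \<open>\<phi>(L) = M\<close> and leave no room for \<open>\<beta> L \<subseteq> M\<close>.)\<close>

definition covering_hom ::
    "('u, 'h::linordered_field, 'v) ns_model \<Rightarrow> real set \<Rightarrow> real set \<Rightarrow> ('h \<Rightarrow> 'h) \<Rightarrow> bool" where
  "covering_hom N L M \<phi> \<longleftrightarrow>
     internal_fun N \<phi> \<and>
     (\<forall>x y. \<phi> (x + y) = \<phi> x + \<phi> y) \<and>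
     \<phi> ` nst N \<subseteq> nst N \<and>
     (\<forall>r\<in>nst N. \<forall>s\<in>hproj N L r. hproj N M (\<phi> s) = hproj N M (\<phi> r))"

text \<open>In the next two definitions \<open>P\<close> is a class of admissible maps on the covering space.\<close>

definition hyper_torus_homs :: "('u, 'h::linordered_field, 'v) ns_model \<Rightarrow> ('h \<Rightarrow> 'h) set \<Rightarrow>
    real set \<Rightarrow> real set \<Rightarrow> ('h set \<Rightarrow> 'h set) set" where
  "hyper_torus_homs N P L M =
     {g \<in> hyper_torus N L \<rightarrow>\<^sub>E hyper_torus N M.
        \<exists>\<phi>\<in>P. covering_hom N L M \<phi> \<and> (\<forall>x\<in>nst N. g (hproj N L x) = hproj N M (\<phi> x))}"

definition quantum_tori_cat :: "('u, 'h::linordered_field, 'v) ns_model \<Rightarrow> ('h \<Rightarrow> 'h) set \<Rightarrow>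
    (real set topology, real set \<Rightarrow> real set) cat" where
  "quantum_tori_cat N P = \<lparr>
     Obj = {quantum_torus L | L. pseudolattice L},
     Hom = (\<lambda>Z W. {f \<in> topspace Z \<rightarrow>\<^sub>E topspace W.
        \<exists>L M. pseudolattice L \<and> pseudolattice M \<and> Z = quantum_torus L \<and> W = quantum_torus M \<and>
          (\<exists>g\<in>hyper_torus_homs N P L M.
             \<forall>t\<in>hyper_torus N L. to_quantum N M (g t) = f (to_quantum N L t))}),
     Ident = (\<lambda>Z. \<lambda>z\<in>topspace Z. z),
     Comp = (\<lambda>Z W Y g f. compose (topspace Z) g f)\<rparr>"

text \<open>\<open>QT\<close> allows every internal additive \<open>\<phi>\<close>, in particular \<open>\<phi> x = - x\<close> and \<open>\<phi> = 0\<close>; its morphisms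
  are exactly the multiplications by real numbers \<open>\<beta>\<close> with \<open>\<beta> L \<subseteq> M\<close>, and it is therefore
  equivalent to \<open>PL_signed\<close>. It is not equivalent to \<open>PL\<close>, whose morphisms are positive:
  \<open>x \<mapsto> - x\<close> is an automorphism of order two of every quantum torus, while no object of \<open>PL\<close>
  has one. The counterpart of \<open>PL\<close> is \<open>QT_pos\<close>, where \<open>\<phi>\<close> has to preserve the orientation.\<close>

definition QT :: "('u, 'h::linordered_field, 'v) ns_model \<Rightarrow>
    (real set topology, real set \<Rightarrow> real set) cat" where
  "QT N = quantum_tori_cat N UNIV"

definition QT_pos :: "('u, 'h::linordered_field, 'v) ns_model \<Rightarrow>
    (real set topology, real set \<Rightarrow> real set) cat" where
  "QT_pos N = quantum_tori_cat N {\<phi>. \<forall>x>0. \<phi> x > 0}"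

end

theory Submission
  imports Defs
begin

text \<open>Let \<open>\<phi>\<close> be internal, additive and map near-standard elements to near-standard elements.
  By saturation \<open>\<phi>\<close> is bounded on \<open>[-2, 2]\<close> by a standard \<open>n\<close>, for otherwise the internal sets
  \<open>{y. \<bar>y\<bar> \<le> 2 \<and> \<bar>\<phi> y\<bar> > n}\<close> would have a common element. Evaluating \<open>\<phi>\<close> at
  \<open>k x - \<lfloor>k st x\<rfloor>\<close> for all standard \<open>k\<close> gives \<open>st (\<phi> x) = \<beta> st x\<close> with \<open>\<beta> = st (\<phi> 1)\<close>. If \<open>\<phi>\<close>
  covers a morphism from \<open>L\<close> to \<open>M\<close>, then \<open>\<phi> l\<close> lies in \<open>M\<close> for \<open>l \<in> L\<close>, so \<open>\<phi> l = \<beta> l\<close> exactly;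
  hence \<open>\<beta> L \<subseteq> M\<close>, and \<open>\<beta>\<close> is positive (not merely nonnegative) if \<open>\<phi>\<close> preserves the orientation.
  Conversely multiplication by such a \<open>\<beta>\<close> is internal by transfer. The map on \<open>Z\<^sub>L\<close> determines \<open>\<beta>\<close>
  because \<open>M \<noteq> \<real>\<close>, and \<open>Z\<^sub>L\<close> determines \<open>L\<close> as its class containing \<open>0\<close>; so the categories are
  even isomorphic.\<close>

section \<open>Superstructures and bounded formulas\<close>

definition Disj :: "bfm \<Rightarrow> bfm \<Rightarrow> bfm" where
  "Disj p q = Neg (Conj (Neg p) (Neg q))"

definition BEx :: "nat \<Rightarrow> nat \<Rightarrow> bfm \<Rightarrow> bfm" where
  "BEx x y p = Neg (BAll x y (Neg p))"

lemma sat_Disj [simp]: "sat S e (Disj p q) \<longleftrightarrow> sat S e p \<or> sat S e q"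
  by (simp add: Disj_def)

lemma sat_BEx [simp]: "sat S e (BEx x y p) \<longleftrightarrow> (\<exists>a. mem S a (e y) \<and> sat S (e(x := a)) p)"
  by (simp add: BEx_def)

text \<open>The bound variables are fresh because they exceed the sum of the free ones.\<close>

definition IsPair :: "nat \<Rightarrow> nat \<Rightarrow> nat \<Rightarrow> bfm" where
  "IsPair w x y =
    (let a = Suc (w + x + y); b = Suc a; c = Suc b in
     BEx a w (BEx b w (Conj (BAll c w (Disj (Eq c a) (Eq c b)))
       (Conj (Conj (Mem x a) (BAll c a (Eq c x)))
             (Conj (Conj (Mem x b) (Mem y b)) (BAll c b (Disj (Eq c x) (Eq c y))))))))"

definition InRel :: "nat \<Rightarrow> nat \<Rightarrow> nat \<Rightarrow> bfm" where
  "InRel r x y = (let w = Suc (r + x + y) in BEx w r (IsPair w x y))"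

text \<open>Bounded quantifiers descend only one membership level at a time: the inner pair
  \<open>p\<close> is not a member of the triple \<open>w\<close>, but a member of some member
  \<open>a\<close> of \<open>w\<close>.\<close>

definition InOp :: "nat \<Rightarrow> nat \<Rightarrow> nat \<Rightarrow> nat \<Rightarrow> bfm" where
  "InOp r x y z =
    (let w = Suc (r + x + y + z); a = Suc w; p = Suc a in
     BEx w r (BEx a w (BEx p a (Conj (IsPair p x y) (IsPair w p z)))))"

section \<open>Sets, Kuratowski pairs and graphs inside a superstructure\<close>

locale superstruct =
  fixes S :: "('a, 'u) superstr"
  assumes superstructure: "superstructure S"
begin

lemma inj_atom: "inj (atom S)"
  using superstructure by (simp add: superstructure_def)

lemma atom_eq_iff [simp]: "atom S x = atom S y \<longleftrightarrow> x = y"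
  using inj_atom by (auto dest: injD)

lemma not_mem_atom [simp]: "\<not> mem S x (atom S a)"
  using superstructure by (auto simp: superstructure_def elems_def)

lemma mem_imp_not_atom: "mem S x u \<Longrightarrow> u \<notin> atoms S"
  by auto

lemma set_ext: "u \<notin> atoms S \<Longrightarrow> v \<notin> atoms S \<Longrightarrow> elems S u = elems S v \<Longrightarrow> u = v"
  using superstructure by (auto simp: superstructure_def)

lemma ex_level: "\<exists>n. u \<in> level S n"
  using superstructure by (auto simp: superstructure_def)

lemma level_mono: "m \<le> n \<Longrightarrow> level S m \<subseteq> level S n"
  by (induction n rule: nat_induct) (auto simp: le_Suc_eq)

lemma set_of:
  assumes "X \<subseteq> level S n"
  shows "set_of S X \<notin> atoms S" "elems S (set_of S X) = X"
proof -
  have "\<exists>u. u \<notin> atoms S \<and> elems S u = X"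
    using superstructure assms by (auto simp: superstructure_def)
  then have "\<exists>!u. u \<notin> atoms S \<and> elems S u = X"
    by (blast intro: set_ext)
  then have "set_of S X \<notin> atoms S \<and> elems S (set_of S X) = X"
    unfolding set_of_def by (rule theI')
  then show "set_of S X \<notin> atoms S" "elems S (set_of S X) = X" by auto
qed

lemma mem_set_of: "X \<subseteq> level S n \<Longrightarrow> mem S x (set_of S X) \<longleftrightarrow> x \<in> X"
  using set_of(2) by (auto simp: elems_def)

lemma set_of_level: "X \<subseteq> level S n \<Longrightarrow> set_of S X \<in> level S (Suc n)"
  by (simp add: set_of)

lemma atom_level [simp]: "atom S x \<in> level S n"
  using level_mono[of 0 n] by auto

lemma doubleton_level: "\<exists>n. {x, y} \<subseteq> level S n"
proof -
  obtain m n where "x \<in> level S m" "y \<in> level S n"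
    using ex_level by meson
  then have "{x, y} \<subseteq> level S (max m n)"
    using level_mono[of m "max m n"] level_mono[of n "max m n"] by auto
  then show ?thesis by blast
qed

lemma singleton_level: "\<exists>n. {x} \<subseteq> level S n"
  using ex_level by auto

lemma mem_singleton [simp]: "mem S z (set_of S {x}) \<longleftrightarrow> z = x"
  using singleton_level[of x] mem_set_of by auto

lemma mem_doubleton [simp]: "mem S z (set_of S {x, y}) \<longleftrightarrow> z = x \<or> z = y"
  using doubleton_level[of x y] mem_set_of by auto

lemma mem_kpair: "mem S z (kpair S x y) \<longleftrightarrow> z = set_of S {x} \<or> z = set_of S {x, y}"
  by (simp add: kpair_def)

text \<open>Atoms have no members, so one known member on each side already rules out atoms and
  makes extensionality applicable.\<close>

lemma mem_ext:
  assumes "mem S x u" "mem S y v" "\<And>z. mem S z u \<longleftrightarrow> mem S z v"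
  shows "u = v"
proof (rule set_ext)
  show "u \<notin> atoms S" by (rule mem_imp_not_atom[OF assms(1)])
  show "v \<notin> atoms S" by (rule mem_imp_not_atom[OF assms(2)])
  show "elems S u = elems S v"
    unfolding elems_def by (rule Collect_cong) (rule assms(3))
qed

lemma singleton_eqI: "mem S x u \<Longrightarrow> \<forall>z. mem S z u \<longrightarrow> z = x \<Longrightarrow> u = set_of S {x}"
  by (rule mem_ext[of x _ x]) (unfold mem_singleton, blast+)

lemma doubleton_eqI:
  "mem S x u \<Longrightarrow> mem S y u \<Longrightarrow> \<forall>z. mem S z u \<longrightarrow> z = x \<or> z = y \<Longrightarrow> u = set_of S {x, y}"
  by (rule mem_ext[of x _ x]) (unfold mem_doubleton, blast+)

lemma kpair_eq_iff [simp]: "kpair S x y = kpair S x' y' \<longleftrightarrow> x = x' \<and> y = y'"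
proof
  assume eq: "kpair S x y = kpair S x' y'"
  have "{set_of S {x}, set_of S {x, y}} = {set_of S {x'}, set_of S {x', y'}}"
    using mem_kpair[of _ x y] mem_kpair[of _ x' y'] eq by auto
  \<comment> \<open>\<open>set_of\<close> is meaningful only for subsets of a level, so its
    injectivity is established by hand for the singletons and doubletons that occur here.\<close>
  moreover have "set_of S {a} = set_of S {b, c} \<longleftrightarrow> a = b \<and> a = c" for a b c
    using mem_singleton[of _ a] mem_doubleton[of _ b c] by (metis insert_absorb2)
  moreover from this have "set_of S {b, c} = set_of S {a} \<longleftrightarrow> a = b \<and> a = c" for a b c
    by metis
  moreover have "set_of S {a} = set_of S {b} \<longleftrightarrow> a = b" for a b
    using mem_singleton by metis
  moreover have "set_of S {a, d} = set_of S {b, c} \<longleftrightarrow> {a, d} = {b, c}" for a b c d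
  proof -
    have "{z. mem S z (set_of S {u, v})} = {u, v}" for u v by auto
    then show ?thesis by metis
  qed
  ultimately show "x = x' \<and> y = y'"
    by (auto simp: doubleton_eq_iff)
qed auto

lemma kpair_level:
  assumes "x \<in> level S n" "y \<in> level S n"
  shows "kpair S x y \<in> level S (Suc (Suc n))"
  unfolding kpair_def
  by (intro set_of_level) (use assms in \<open>auto intro!: set_of_level[of _ n, simplified] simp: set_of\<close>)

text \<open>Each block of the formula says "these members and no others", which extensionality turns
  into an equation with \<open>set_of\<close>. As a simp rule it evaluates formulas in both models
  before and after transfer.\<close>

lemma sat_IsPair [simp]: "sat S e (IsPair w x y) \<longleftrightarrow> e w = kpair S (e x) (e y)"
proof -
  have sing: "mem S u a \<and> (\<forall>c. mem S c a \<longrightarrow> c = u) \<longleftrightarrow> a = set_of S {u}" for a u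
    by (metis singleton_eqI mem_singleton)
  have doub: "mem S u a \<and> mem S v a \<and> (\<forall>c. mem S c a \<longrightarrow> c = u \<or> c = v) \<longleftrightarrow> a = set_of S {u, v}"
    for a u v by (metis doubleton_eqI mem_doubleton)
  have "sat S e (IsPair w x y) \<longleftrightarrow>
      (\<exists>a. mem S a (e w) \<and> (\<exists>b. mem S b (e w) \<and> (\<forall>c. mem S c (e w) \<longrightarrow> c = a \<or> c = b) \<and>
        a = set_of S {e x} \<and> b = set_of S {e x, e y}))"
    by (simp add: IsPair_def Let_def sing doub)
  also have "\<dots> \<longleftrightarrow> e w = kpair S (e x) (e y)"
    unfolding kpair_def doub[of "set_of S {e x}" "e w" "set_of S {e x, e y}", symmetric] by blast
  finally show ?thesis .
qed

lemma sat_InRel [simp]: "sat S e (InRel r x y) \<longleftrightarrow> mem S (kpair S (e x) (e y)) (e r)"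
  by (auto simp: InRel_def Let_def)

lemma sat_InOp [simp]:
  "sat S e (InOp r x y z) \<longleftrightarrow> mem S (kpair S (kpair S (e x) (e y)) (e z)) (e r)"
proof
  assume "sat S e (InOp r x y z)"
  then show "mem S (kpair S (kpair S (e x) (e y)) (e z)) (e r)"
    by (auto simp: InOp_def Let_def)
next
  assume r: "mem S (kpair S (kpair S (e x) (e y)) (e z)) (e r)"
  \<comment> \<open>The singleton of the inner pair serves as witness for the middle quantifier of
    \<open>InOp\<close>.\<close>
  have p: "mem S (kpair S (e x) (e y)) (set_of S {kpair S (e x) (e y)})"
    "mem S (set_of S {kpair S (e x) (e y)}) (kpair S (kpair S (e x) (e y)) (e z))"
    by (simp_all add: mem_kpair)
  show "sat S e (InOp r x y z)"
    by (simp add: InOp_def Let_def) (use r p in blast)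
qed

lemma mem_atoms [simp]: "mem S u (set_of S (atoms S)) \<longleftrightarrow> u \<in> atoms S"
  by (rule mem_set_of[of _ 0]) auto

lemma pairs_level: "{kpair S (atom S x) (atom S y) | x y. R x y} \<subseteq> level S 2"
  using kpair_level[of _ 0] by (auto simp: numeral_2_eq_2 simp del: level.simps)

lemma fun_graph_eq: "fun_graph S f = rel_graph S (\<lambda>x y. y = f x)"
  by (simp add: fun_graph_def rel_graph_def)

lemma rel_graph_not_atom: "rel_graph S R \<notin> atoms S"
  unfolding rel_graph_def by (rule set_of[OF pairs_level])

lemma mem_rel_graph:
  "mem S u (rel_graph S R) \<longleftrightarrow> (\<exists>x y. R x y \<and> u = kpair S (atom S x) (atom S y))"
  unfolding rel_graph_def mem_set_of[OF pairs_level] by auto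

lemma kpair_mem_op_graph [simp]:
  "mem S (kpair S (kpair S (atom S x) (atom S y)) (atom S z)) (op_graph S f) \<longleftrightarrow> z = f x y"
proof -
  \<comment> \<open>Each pairing raises the level by two, and a triple is a pair whose first entry
    is a pair of atoms.\<close>
  have "{kpair S (kpair S (atom S x) (atom S y)) (atom S (f x y)) | x y. True} \<subseteq> level S 4"
    using kpair_level[OF kpair_level[of _ 0], of "atom S _" "atom S _" "atom S _"]
    by (auto simp: eval_nat_numeral simp del: level.simps)
  from mem_set_of[OF this] show ?thesis
    unfolding op_graph_def by auto
qed

lemma kpair_mem_rel_graph [simp]:
  "mem S (kpair S (atom S x) (atom S y)) (rel_graph S R) \<longleftrightarrow> R x y"
  by (auto simp: mem_rel_graph)

end


section \<open>The embedding of the reals into the hyperreals\<close>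

locale nonstandard =
  fixes N :: "('u, 'h::linordered_field, 'v) ns_model"
  assumes model: "nonstandard_model N"
begin

sublocale R: superstruct "VR N"
  using model by unfold_locales (simp add: nonstandard_model_def)

sublocale H: superstruct "VH N"
  using model by unfold_locales (simp add: nonstandard_model_def)

text \<open>Parameters come as a list, variable \<open>i\<close> denoting its entry
  \<open>i\<close>; the formulas below use larger indices for bound variables.\<close>

lemma transfer: "sat (VR N) ((!) us) p \<longleftrightarrow> sat (VH N) (\<lambda>i. star N (us ! i)) p"
  using model by (auto simp: nonstandard_model_def transfer_principle_def comp_def)

lemma star_atoms: "star N (set_of (VR N) (atoms (VR N))) = set_of (VH N) (atoms (VH N))"
  and star_plus: "star N (op_graph (VR N) (+)) = op_graph (VH N) (+)"
  and star_times: "star N (op_graph (VR N) (*)) = op_graph (VH N) (*)"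
  and star_less: "star N (rel_graph (VR N) (<)) = rel_graph (VH N) (<)"
  using model by (auto simp: nonstandard_model_def)

lemma star_mem_iff: "mem (VH N) (star N u) (star N v) \<longleftrightarrow> mem (VR N) u v"
  using transfer[of "[u, v]" "Mem 0 1"] by simp

text \<open>Being an atom is membership in the set of all atoms, whose star is again the set of all
  atoms. This makes the \<open>THE\<close> in \<open>hyper\<close> well defined.\<close>

lemma star_atom [simp]: "star N (atom (VR N) r) = atom (VH N) (hyper N r)"
proof -
  have "star N (atom (VR N) r) \<in> atoms (VH N)"
    using star_mem_iff[of "atom (VR N) r" "set_of (VR N) (atoms (VR N))"]
    by (simp add: star_atoms)
  then obtain h where "star N (atom (VR N) r) = atom (VH N) h" by auto
  then show ?thesis unfolding hyper_def by (auto intro: theI2)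
qed

lemma hyper_add: "hyper N (a + b) = hyper N a + hyper N b"
  using transfer[of "[op_graph (VR N) (+), atom (VR N) a, atom (VR N) b, atom (VR N) (a + b)]"
      "InOp 0 1 2 3"]
  by (simp add: star_plus)

lemma hyper_mult: "hyper N (a * b) = hyper N a * hyper N b"
  using transfer[of "[op_graph (VR N) (*), atom (VR N) a, atom (VR N) b, atom (VR N) (a * b)]"
      "InOp 0 1 2 3"]
  by (simp add: star_times)

lemma hyper_less_iff [simp]: "hyper N a < hyper N b \<longleftrightarrow> a < b"
  using transfer[of "[rel_graph (VR N) (<), atom (VR N) a, atom (VR N) b]" "InRel 0 1 2"]
  by (simp add: star_less)

lemma hyper_le_iff [simp]: "hyper N a \<le> hyper N b \<longleftrightarrow> a \<le> b"
  by (meson hyper_less_iff linorder_not_less)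

lemma hyper_eq_iff [simp]: "hyper N a = hyper N b \<longleftrightarrow> a = b"
  by (simp add: order_eq_iff)

lemma hyper_0 [simp]: "hyper N 0 = 0"
  using hyper_add[of 0 0] by simp

text \<open>A nonzero idempotent of a field equals 1.\<close>

lemma hyper_1 [simp]: "hyper N 1 = 1"
  using hyper_mult[of 1 1] hyper_eq_iff[of 1 0] by (simp del: hyper_eq_iff)

lemma hyper_minus: "hyper N (- a) = - hyper N a"
  using hyper_add[of a "- a"] by (simp add: eq_neg_iff_add_eq_0 add.commute)

lemma hyper_diff: "hyper N (a - b) = hyper N a - hyper N b"
  using hyper_add[of a "- b"] by (simp add: hyper_minus)

lemma hyper_of_nat [simp]: "hyper N (of_nat n) = of_nat n"
  by (induction n) (simp_all add: hyper_add)

lemma hyper_of_int [simp]: "hyper N (of_int n) = of_int n"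
  by (cases n rule: int_diff_cases) (simp add: hyper_diff)

lemma hyper_less_0_iff [simp]: "0 < hyper N a \<longleftrightarrow> 0 < a"
  using hyper_less_iff[of 0 a] by simp

lemma hyper_abs: "hyper N \<bar>a\<bar> = \<bar>hyper N a\<bar>"
  using hyper_less_iff[of a 0] by (simp add: abs_if hyper_minus)


section \<open>Standard parts\<close>

text \<open>With images of reals on both sides of \<open>x\<close>, chains of inequalities can be
  pulled back to the reals by \<open>hyper_less_iff\<close>.\<close>

lemma inf_close_hyper_iff:
  "inf_close N x (hyper N r) \<longleftrightarrow> (\<forall>e>0. hyper N (r - e) < x \<and> x < hyper N (r + e))"
  by (auto simp: inf_close_def abs_less_iff hyper_add hyper_diff algebra_simps)

lemma inf_close_unique:
  assumes "inf_close N x (hyper N r)" "inf_close N x (hyper N s)"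
  shows "r = s"
proof (rule ccontr)
  assume "r \<noteq> s"
  \<comment> \<open>With this radius the open intervals around \<open>r\<close> and \<open>s\<close>
    are disjoint, yet \<open>x\<close> would lie in both.\<close>
  define e where "e = \<bar>r - s\<bar> / 2"
  have "e > 0" using \<open>r \<noteq> s\<close> by (simp add: e_def)
  then have "hyper N (r - e) < hyper N (s + e)" "hyper N (s - e) < hyper N (r + e)"
    using assms unfolding inf_close_hyper_iff by (meson less_trans)+
  then show False by (auto simp: e_def abs_if field_simps split: if_splits)
qed

lemma st_eq: "inf_close N x (hyper N r) \<Longrightarrow> st N x = r"
  unfolding st_def by (blast intro: the_equality inf_close_unique)

lemma nstI: "inf_close N x (hyper N r) \<Longrightarrow> x \<in> nst N"
  by (auto simp: nst_def)

lemma inf_close_st: "x \<in> nst N \<Longrightarrow> inf_close N x (hyper N (st N x))"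
  by (auto simp: nst_def st_eq)

lemma inf_close_hyper [simp]: "inf_close N (hyper N r) (hyper N r)"
  by (simp add: inf_close_def)

lemma nst_hyper [simp]: "hyper N r \<in> nst N"
  by (rule nstI[OF inf_close_hyper])

lemma nst_0 [simp]: "0 \<in> nst N"
  using nst_hyper[of 0] by simp

lemma st_hyper [simp]: "st N (hyper N r) = r"
  by (rule st_eq) simp

lemma inf_close_add:
  assumes "inf_close N x (hyper N r)" "inf_close N y (hyper N s)"
  shows "inf_close N (x + y) (hyper N (r + s))"
  unfolding inf_close_hyper_iff
proof (intro allI impI)
  fix e :: real assume "e > 0"
  then have "hyper N (r - e/2) < x \<and> x < hyper N (r + e/2)"
    "hyper N (s - e/2) < y \<and> y < hyper N (s + e/2)"
    using assms unfolding inf_close_hyper_iff by auto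
  then have "hyper N (r - e/2) + hyper N (s - e/2) < x + y"
    "x + y < hyper N (r + e/2) + hyper N (s + e/2)"
    by (auto intro: add_strict_mono)
  then show "hyper N (r + s - e) < x + y \<and> x + y < hyper N (r + s + e)"
    unfolding hyper_add[symmetric] by (simp add: algebra_simps)
qed

lemma inf_close_hyper_mult:
  assumes "inf_close N x (hyper N r)"
  shows "inf_close N (hyper N a * x) (hyper N (a * r))"
proof (cases "a = 0")
  case True
  then show ?thesis using inf_close_hyper[of 0] by simp
next
  case False
  show ?thesis
    unfolding inf_close_def
  proof (intro allI impI)
    fix e :: real assume "e > 0"
    then have "\<bar>x - hyper N r\<bar> < hyper N (e / \<bar>a\<bar>)"
      using assms False by (simp add: inf_close_def)
    then have "hyper N \<bar>a\<bar> * \<bar>x - hyper N r\<bar> < hyper N \<bar>a\<bar> * hyper N (e / \<bar>a\<bar>)"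
      using False by (intro mult_strict_left_mono) auto
    also have "\<dots> = hyper N e"
      using False by (simp add: hyper_mult[symmetric])
    finally show "\<bar>hyper N a * x - hyper N (a * r)\<bar> < hyper N e"
      by (simp add: hyper_abs hyper_mult abs_mult[symmetric] right_diff_distrib)
  qed
qed

lemma nst_add: "x \<in> nst N \<Longrightarrow> y \<in> nst N \<Longrightarrow> x + y \<in> nst N"
  and st_add: "x \<in> nst N \<Longrightarrow> y \<in> nst N \<Longrightarrow> st N (x + y) = st N x + st N y"
  using inf_close_add[OF inf_close_st inf_close_st] nstI st_eq by blast+

lemma nst_hyper_mult: "x \<in> nst N \<Longrightarrow> hyper N a * x \<in> nst N"
  and st_hyper_mult: "x \<in> nst N \<Longrightarrow> st N (hyper N a * x) = a * st N x"
  using inf_close_hyper_mult[OF inf_close_st] nstI st_eq by blast+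

lemma abs_st_le:
  assumes "x \<in> nst N" "\<bar>x\<bar> \<le> hyper N c"
  shows "\<bar>st N x\<bar> \<le> c"
proof -
  have "st N x \<le> c + e \<and> - st N x \<le> c + e" if "e > 0" for e
  proof -
    have "hyper N (st N x - e) < x" "x < hyper N (st N x + e)"
      using inf_close_st[OF assms(1)] that unfolding inf_close_hyper_iff by auto
    moreover have "x \<le> hyper N c" "hyper N (- c) \<le> x"
      using assms(2) by (auto simp: abs_le_iff hyper_minus minus_le_iff)
    ultimately have "hyper N (st N x - e) < hyper N c" "hyper N (- c) < hyper N (st N x + e)"
      by (meson less_le_trans le_less_trans)+
    then show ?thesis by simp
  qed
  then show ?thesis by (meson abs_leI field_le_epsilon)
qed

lemma nst_limited:
  assumes "x \<in> nst N"
  obtains n :: nat where "\<bar>x\<bar> \<le> hyper N (of_nat n)"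
proof -
  obtain n :: nat where n: "\<bar>st N x\<bar> + 1 \<le> of_nat n"
    using real_arch_simple by blast
  have "hyper N (st N x - 1) < x" "x < hyper N (st N x + 1)"
    using inf_close_st[OF assms] zero_less_one unfolding inf_close_hyper_iff by blast+
  moreover have "hyper N (st N x + 1) \<le> hyper N (of_nat n)"
    "hyper N (- of_nat n) \<le> hyper N (st N x - 1)"
    unfolding hyper_le_iff using n by linarith+
  ultimately have "\<bar>x\<bar> \<le> hyper N (of_nat n)"
    unfolding abs_le_iff hyper_minus by linarith
  then show ?thesis by (rule that)
qed

text \<open>Completeness of the reals: the supremum of the reals not exceeding \<open>x\<close> is
  its standard part.\<close>

lemma nst_of_limited:
  assumes "\<bar>x\<bar> \<le> hyper N c"
  shows "x \<in> nst N"
proof -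
  have x: "hyper N (- c) \<le> x" "x \<le> hyper N c"
    using assms by (auto simp: abs_le_iff hyper_minus minus_le_iff)
  define A where "A = {q. hyper N q \<le> x}"
  have A: "A \<noteq> {}" "bdd_above A"
    unfolding A_def using x
    by (auto intro!: bdd_aboveI[of _ c]) (meson hyper_le_iff order_trans)
  have "inf_close N x (hyper N (Sup A))"
    unfolding inf_close_hyper_iff
  proof (intro allI impI conjI)
    fix e :: real assume "e > 0"
    then obtain q where "q \<in> A" "Sup A - e < q"
      using A less_cSup_iff[of A "Sup A - e"] by auto
    then show "hyper N (Sup A - e) < x"
      unfolding A_def by (metis hyper_less_iff less_le_trans mem_Collect_eq)
    have "Sup A + e \<notin> A"
      using \<open>e > 0\<close> cSup_upper[OF _ A(2), of "Sup A + e"] by auto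
    then show "x < hyper N (Sup A + e)" by (simp add: A_def)
  qed
  then show ?thesis by (rule nstI)
qed


section \<open>Internal additive maps\<close>

text \<open>The graph of \<open>x \<mapsto> hyper N b * x\<close> is the star of the corresponding
  real graph \<open>?F\<close>, and every star is internal, being a member of the star of a
  singleton.\<close>

lemma internal_times: "internal_fun N (\<lambda>x. hyper N b * x)"
proof -
  let ?F = "rel_graph (VR N) (\<lambda>x y. y = b * x)"
  let ?us = "[?F, op_graph (VR N) (*), set_of (VR N) (atoms (VR N)), atom (VR N) b]"
  let ?G = "rel_graph (VH N) (\<lambda>x y. y = hyper N b * x)"
  \<comment> \<open>The sentences \<open>1\<close> and \<open>2\<close> express the two inclusions
    between \<open>?F\<close> and the graph of multiplication by \<open>b\<close>; transferred, they
    give the two inclusions between \<open>star N ?F\<close> and \<open>?G\<close>.\<close>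
  have 1: "sat (VR N) ((!) ?us) (BAll 4 0 (BEx 5 2 (BEx 6 2 (Conj (IsPair 4 5 6) (InOp 1 3 5 6)))))"
    by (auto simp: R.mem_rel_graph)
  have 2: "sat (VR N) ((!) ?us) (BAll 5 2 (BAll 6 2 (Disj (Neg (InOp 1 3 5 6)) (InRel 0 5 6))))"
    by auto
  have "star N ?F \<notin> atoms (VH N)"
    using star_mem_iff[of ?F "set_of (VR N) (atoms (VR N))"] R.rel_graph_not_atom
    by (simp add: star_atoms)
  moreover have "elems (VH N) (star N ?F) = elems (VH N) ?G"
  proof (intro set_eqI iffI)
    fix u assume "u \<in> elems (VH N) (star N ?F)"
    then show "u \<in> elems (VH N) ?G"
      using 1 unfolding transfer by (auto simp: elems_def H.mem_rel_graph star_atoms star_times)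
  next
    fix u assume "u \<in> elems (VH N) ?G"
    then show "u \<in> elems (VH N) (star N ?F)"
      using 2 unfolding transfer by (auto simp: elems_def H.mem_rel_graph star_atoms star_times)
  qed
  ultimately have "star N ?F = ?G"
    by (intro H.set_ext H.rel_graph_not_atom)
  then have "mem (VH N) ?G (star N (set_of (VR N) {?F}))"
    using star_mem_iff[of ?F "set_of (VR N) {?F}"] by simp
  then show ?thesis
    unfolding internal_fun_def internal_def H.fun_graph_eq by blast
qed

text \<open>The internal definition principle, obtained by transferring that every \<open>f \<in> B\<close> has such an
  exceptional set among the subsets of the reals.\<close>

lemma internal_exceptional_set:
  assumes "internal_fun N \<phi>"
  obtains D where "internal N D"
    "elems (VH N) D = atom (VH N) `
       {y. \<bar>y\<bar> \<le> hyper N c \<and> hyper N d < \<bar>\<phi> y\<bar>}"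
proof -
  let ?X = "set_of (VR N) (atoms (VR N))"
  let ?PX = "{D. D \<notin> atoms (VR N) \<and> elems (VR N) D \<subseteq> atoms (VR N)}"
  define P where "P = set_of (VR N) ?PX"
  have "mem (VR N) D P \<longleftrightarrow> D \<in> ?PX" for D
    unfolding P_def by (rule R.mem_set_of[of _ 1]) auto
  then have PX: "mem (VR N) D P \<longleftrightarrow> D \<notin> atoms (VR N) \<and> elems (VR N) D \<subseteq> atoms (VR N)" for D
    by simp
  obtain B where B: "mem (VH N) (fun_graph (VH N) \<phi>) (star N B)"
    using assms by (auto simp: internal_fun_def internal_def)
  let ?us = "[B, ?X, P, rel_graph (VR N) (<),
    atom (VR N) c, atom (VR N) (- c), atom (VR N) d, atom (VR N) (- d)]"
  \<comment> \<open>Variable 8 is the function, 9 its exceptional set, 10 the argument and 11 the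
    value. Absolute values are expressed by comparing with \<open>c\<close>, \<open>- c\<close>,
    \<open>d\<close> and \<open>- d\<close>, the parameters 4 to 7.\<close>
  define p where "p = Conj (Conj (Neg (InRel 3 4 10)) (Neg (InRel 3 10 5)))
    (BEx 11 1 (Conj (InRel 8 10 11) (Disj (InRel 3 6 11) (InRel 3 11 7))))"
  let ?q = "BAll 8 0 (BEx 9 2 (BAll 10 1
    (Conj (Disj (Neg (Mem 10 9)) p) (Disj (Mem 10 9) (Neg p)))))"
  have "sat (VR N) ((!) ?us) ?q"
    unfolding sat.simps sat_BEx
  proof (intro allI impI, goal_cases)
    case (1 f)
    let ?Y = "{y \<in> atoms (VR N). sat (VR N) (((!) ?us)(8 := f, 10 := y)) p}"
    have Y: "?Y \<subseteq> level (VR N) 0" by auto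
    show ?case
      apply (rule exI[of _ "set_of (VR N) ?Y"])
      using R.set_of[OF Y] R.mem_set_of[OF Y]
      by (auto simp: PX p_def)
  qed
  then have "sat (VH N) (\<lambda>i. star N (?us ! i)) ?q"
    unfolding transfer .
  then obtain D where D: "mem (VH N) D (star N P)"
    "\<forall>y. mem (VH N) y (set_of (VH N) (atoms (VH N))) \<longrightarrow>
      (mem (VH N) y D \<longleftrightarrow>
       sat (VH N) ((\<lambda>i. star N (?us ! i))(8 := fun_graph (VH N) \<phi>, 9 := D, 10 := y)) p)"
    using B by (simp add: star_atoms) blast
  \<comment> \<open>The sentence \<open>?q\<close> only decides which atoms belong to
    \<open>D\<close>; a second transferred sentence excludes all other members.\<close>
  have "sat (VR N) ((!) ?us) (BAll 8 2 (BAll 9 8 (Mem 9 1)))"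
    by (simp add: PX) (auto simp: elems_def)
  then have "elems (VH N) D \<subseteq> atoms (VH N)"
    using D(1) unfolding transfer by (auto simp: star_atoms elems_def)
  moreover have "mem (VH N) (atom (VH N) y) D \<longleftrightarrow> \<bar>y\<bar> \<le> hyper N c \<and> hyper N d < \<bar>\<phi> y\<bar>" for y
  proof -
    have "\<bar>y\<bar> \<le> hyper N c \<longleftrightarrow> \<not> hyper N c < y \<and> \<not> y < - hyper N c"
      "hyper N d < \<bar>\<phi> y\<bar> \<longleftrightarrow> hyper N d < \<phi> y \<or> \<phi> y < - hyper N d"
      by linarith+
    then show ?thesis
      using D(2)[rule_format, of "atom (VH N) y"]
      by (auto simp: p_def star_less star_atoms H.fun_graph_eq hyper_minus)
  qed
  ultimately have "elems (VH N) D = atom (VH N) ` {y. \<bar>y\<bar> \<le> hyper N c \<and> hyper N d < \<bar>\<phi> y\<bar>}"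
    by (auto simp: elems_def)
  moreover have "internal N D"
    using D(1) by (auto simp: internal_def)
  ultimately show ?thesis by (rule that[rotated])
qed

lemma internal_fun_bounded:
  assumes "internal_fun N \<phi>" "\<phi> ` nst N \<subseteq> nst N"
  obtains n :: nat where "\<And>y. \<bar>y\<bar> \<le> hyper N c \<Longrightarrow> \<bar>\<phi> y\<bar> \<le> hyper N (of_nat n)"
proof (rule ccontr)
  assume "\<not> thesis"
  with that have unbounded: "\<exists>y. \<bar>y\<bar> \<le> hyper N c \<and> hyper N (of_nat n) < \<bar>\<phi> y\<bar>" for n :: nat
    by (meson not_le)
  have "\<exists>D. internal N D \<and> elems (VH N) D = atom (VH N) `
      {y. \<bar>y\<bar> \<le> hyper N c \<and> hyper N (of_nat n) < \<bar>\<phi> y\<bar>}" for n :: nat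
    using internal_exceptional_set[OF assms(1)] by metis
  then obtain D where D: "\<And>n. internal N (D n)"
    "\<And>n. elems (VH N) (D n) = atom (VH N) `
      {y. \<bar>y\<bar> \<le> hyper N c \<and> hyper N (of_nat n) < \<bar>\<phi> y\<bar>}"
    by metis
  \<comment> \<open>The sets decrease with the index, so any element of the last one lies in the
    whole finite intersection.\<close>
  have "(\<Inter>i\<le>n. elems (VH N) (D i)) \<noteq> {}" for n
  proof -
    obtain y where y: "\<bar>y\<bar> \<le> hyper N c" "hyper N (of_nat n) < \<bar>\<phi> y\<bar>"
      using unbounded by blast
    have "hyper N (of_nat i) < \<bar>\<phi> y\<bar>" if "i \<le> n" for i
      using y(2) that by (meson hyper_le_iff le_less_trans of_nat_le_iff)
    then have "atom (VH N) y \<in> (\<Inter>i\<le>n. elems (VH N) (D i))"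
      unfolding D(2) using y(1) by blast
    then show ?thesis by blast
  qed
  moreover have "saturated N"
    using model by (simp add: nonstandard_model_def)
  ultimately have "(\<Inter>i. elems (VH N) (D i)) \<noteq> {}"
    using D(1) unfolding saturated_def by blast
  then obtain u where u: "\<And>i. u \<in> elems (VH N) (D i)" by blast
  then obtain y where y: "u = atom (VH N) y" "\<bar>y\<bar> \<le> hyper N c"
    using u[of 0] unfolding D(2) by blast
  have large: "hyper N (of_nat n) < \<bar>\<phi> y\<bar>" for n :: nat
    using u[of n] unfolding D(2) y(1) by auto
  \<comment> \<open>The common element \<open>y\<close> is limited, hence so is
    \<open>\<phi> y\<close>, which contradicts \<open>large\<close>.\<close>
  have "\<phi> y \<in> nst N"
    using assms(2) nst_of_limited[OF y(2)] by blast
  then obtain n :: nat where "\<bar>\<phi> y\<bar> \<le> hyper N (of_nat n)"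
    by (rule nst_limited)
  with large[of n] show False by simp
qed

section \<open>The standard part of an internal additive map\<close>

lemma abs_le_of_st:
  assumes "x \<in> nst N" "\<bar>st N x\<bar> < c"
  shows "\<bar>x\<bar> \<le> hyper N c"
proof -
  define e where "e = c - \<bar>st N x\<bar>"
  have "e > 0" using assms(2) by (simp add: e_def)
  then have "hyper N (st N x - e) < x" "x < hyper N (st N x + e)"
    using inf_close_st[OF assms(1)] unfolding inf_close_hyper_iff by auto
  moreover have "hyper N (- c) \<le> hyper N (st N x - e)" "hyper N (st N x + e) \<le> hyper N c"
    unfolding hyper_le_iff e_def by linarith+
  ultimately show ?thesis unfolding abs_le_iff hyper_minus by linarith
qed

lemma additive_of_int_mult:
  assumes "\<And>x y. \<phi> (x + y) = \<phi> x + \<phi> (y::'h)"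
  shows "\<phi> (of_int m * x) = of_int m * (\<phi> x :: 'h)"
proof -
  interpret additive \<phi> by unfold_locales (rule assms)
  have nat: "\<phi> (of_nat k * x) = of_nat k * \<phi> x" for k
    by (induction k) (simp_all add: zero assms distrib_right)
  show ?thesis
    by (cases m rule: int_diff_cases) (simp add: left_diff_distrib diff nat)
qed

lemma st_internal_additive:
  assumes "internal_fun N \<phi>" "\<phi> ` nst N \<subseteq> nst N"
    and add: "\<And>x y. \<phi> (x + y) = \<phi> x + \<phi> y"
  obtains \<beta> where "\<And>x. x \<in> nst N \<Longrightarrow> st N (\<phi> x) = \<beta> * st N x"
proof -
  obtain n :: nat where n: "\<And>y. \<bar>y\<bar> \<le> hyper N 2 \<Longrightarrow> \<bar>\<phi> y\<bar> \<le> hyper N (of_nat n)"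
    using internal_fun_bounded[OF assms(1,2)] by blast
  have nst: "\<phi> x \<in> nst N" if "x \<in> nst N" for x
    using assms(2) that by blast
  have one: "1 \<in> nst N" using nst_hyper[of 1] by simp
  define \<beta> where "\<beta> = st N (\<phi> 1)"
  have "st N (\<phi> x) = \<beta> * st N x" if x: "x \<in> nst N" for x
  proof -
    \<comment> \<open>The defect of linearity at \<open>x\<close>. Its multiples by all natural
      numbers obey one common bound, so the Archimedean property forces it to be 0.\<close>
    define d where "d = st N (\<phi> x) - \<beta> * st N x"
    have bound: "of_nat k * \<bar>d\<bar> \<le> of_nat n + \<bar>\<beta>\<bar>" for k :: nat
    proof -
      \<comment> \<open>Subtracting this integer moves the standard part of \<open>k x\<close> into
        the interval from 0 to 1, so the bound \<open>n\<close> applies to \<open>y\<close> whatever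
        \<open>k\<close> is.\<close>
      define m where "m = \<lfloor>of_nat k * st N x\<rfloor>"
      define y where "y = hyper N (of_int (int k)) * x + hyper N (of_int (- m))"
      have y: "y \<in> nst N" "st N y = of_nat k * st N x - of_int m"
        using x by (simp_all add: y_def nst_add st_add nst_hyper_mult st_hyper_mult
            del: hyper_of_int hyper_of_nat of_int_of_nat_eq of_int_minus)
      have frac: "0 \<le> of_nat k * st N x - of_int m" "of_nat k * st N x - of_int m < 1"
        unfolding m_def by linarith+
      then have "\<bar>y\<bar> \<le> hyper N 2"
        using y by (intro abs_le_of_st) auto
      then have "\<bar>\<phi> y\<bar> \<le> hyper N (of_nat n)" by (rule n)
      then have "\<bar>st N (\<phi> y)\<bar> \<le> of_nat n"
        by (intro abs_st_le nst y)
      moreover have "\<phi> y = hyper N (of_int (int k)) * \<phi> x + hyper N (of_int (- m)) * \<phi> 1"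
        unfolding y_def hyper_of_int add
        using additive_of_int_mult[of \<phi> "int k" x, OF add]
          additive_of_int_mult[of \<phi> "- m" 1, OF add] by simp
      then have "st N (\<phi> y) = of_int (int k) * st N (\<phi> x) + of_int (- m) * \<beta>"
        unfolding \<beta>_def using nst[OF x] nst[OF one]
        by (simp only: st_add st_hyper_mult nst_hyper_mult)
      \<comment> \<open>The integer \<open>m\<close> contributes \<open>m * \<beta>\<close> to both
        terms and cancels: \<open>y\<close> has \<open>k\<close> times the defect of
        \<open>x\<close>.\<close>
      then have "of_nat k * d = st N (\<phi> y) - \<beta> * (of_nat k * st N x - of_int m)"
        by (simp add: d_def algebra_simps)
      moreover have "\<bar>\<beta> * (of_nat k * st N x - of_int m)\<bar> \<le> \<bar>\<beta>\<bar>"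
        using frac by (simp add: abs_mult mult_left_le)
      moreover have "of_nat k * \<bar>d\<bar> = \<bar>of_nat k * d\<bar>" by (simp add: abs_mult)
      ultimately show ?thesis by linarith
    qed
    have "d = 0"
    proof (rule ccontr)
      assume "d \<noteq> 0"
      then obtain k :: nat where "of_nat n + \<bar>\<beta>\<bar> < of_nat k * \<bar>d\<bar>"
        using reals_Archimedean3[of "\<bar>d\<bar>"] by auto
      with bound[of k] show False by simp
    qed
    then show ?thesis by (simp add: d_def)
  qed
  then show ?thesis by (rule that)
qed

end


section \<open>Pseudolattices and quantum tori\<close>

lemma pseudolattice_zero: "pseudolattice L \<Longrightarrow> 0 \<in> L"
  by (simp add: pseudolattice_def)

lemma pseudolattice_diff: "pseudolattice L \<Longrightarrow> x \<in> L \<Longrightarrow> y \<in> L \<Longrightarrow> x - y \<in> L"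
  by (simp add: pseudolattice_def)

lemma pseudolattice_minus: "pseudolattice L \<Longrightarrow> x \<in> L \<Longrightarrow> - x \<in> L"
  using pseudolattice_diff[of L 0 x] pseudolattice_zero[of L] by simp

lemma pseudolattice_add: "pseudolattice L \<Longrightarrow> x \<in> L \<Longrightarrow> y \<in> L \<Longrightarrow> x + y \<in> L"
  using pseudolattice_diff[of L x "- y"] pseudolattice_minus[of L y] by simp

lemma pseudolattice_basis:
  assumes "pseudolattice L"
  obtains a b :: real where "\<And>m n :: int. of_int m * a + of_int n * b = 0 \<Longrightarrow> m = 0 \<and> n = 0"
    "L = {of_int m * a + of_int n * b | m n :: int. True}"
  using assms unfolding pseudolattice_def by blast

text \<open>A basis element is nonzero by independence, so it or its negative is positive. The sign
  of a multiplier is later read off at such an element.\<close>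

lemma pseudolattice_positive:
  assumes "pseudolattice L"
  obtains l where "l \<in> L" "l > 0"
proof -
  obtain a b :: real where ab: "\<And>m n :: int. of_int m * a + of_int n * b = 0 \<Longrightarrow> m = 0 \<and> n = 0"
    "L = {of_int m * a + of_int n * b | m n :: int. True}"
    by (rule pseudolattice_basis[OF assms]) blast
  have "a \<noteq> 0" using ab(1)[of 1 0] by auto
  have "a = of_int 1 * a + of_int 0 * b" by simp
  then have "a \<in> L" unfolding ab(2) by blast
  with \<open>a \<noteq> 0\<close> that[of a] that[of "- a"] show ?thesis
    using pseudolattice_minus[OF assms] by (metis neg_0_less_iff_less linorder_neqE)
qed

text \<open>Half of a basis element is missing: its coefficient \<open>m\<close> would satisfy
  \<open>2 * m = 1\<close>.\<close>

lemma pseudolattice_neq_UNIV: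
  assumes "pseudolattice L"
  shows "L \<noteq> UNIV"
proof
  assume "L = UNIV"
  obtain a b :: real where ab: "\<And>m n :: int. of_int m * a + of_int n * b = 0 \<Longrightarrow> m = 0 \<and> n = 0"
    "L = {of_int m * a + of_int n * b | m n :: int. True}"
    by (rule pseudolattice_basis[OF assms]) blast
  have "a / 2 \<in> L" using \<open>L = UNIV\<close> by simp
  then obtain m n :: int where "a / 2 = of_int m * a + of_int n * b"
    unfolding ab(2) by blast
  then have "of_int (2 * m - 1) * a + of_int (2 * n) * b = 0"
    by (simp add: field_simps)
  then have "2 * m - 1 = 0" using ab(1) by blast
  then show False by presburger
qed

section \<open>Classes modulo a pseudolattice and the maps induced by multipliers\<close>

lemma proj_eq_iff:
  assumes "pseudolattice L"
  shows "proj L x = proj L y \<longleftrightarrow> x - y \<in> L"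
proof
  assume "proj L x = proj L y"
  moreover have "x \<in> proj L x"
    using pseudolattice_zero[OF assms] by (force simp: proj_def)
  ultimately obtain l where "l \<in> L" "x = y + l" by (auto simp: proj_def)
  then show "x - y \<in> L" by simp
next
  assume xy: "x - y \<in> L"
  have "x + l \<in> proj L y" if "l \<in> L" for l
    unfolding proj_def using pseudolattice_add[OF assms xy that] by (auto intro!: image_eqI[of _ _ "x - y + l"])
  moreover have "y + l \<in> proj L x" if "l \<in> L" for l
    unfolding proj_def using pseudolattice_diff[OF assms that xy] by (auto intro!: image_eqI[of _ _ "l - (x - y)"])
  ultimately show "proj L x = proj L y"
    by (auto simp: proj_def)
qed

lemma topspace_quantum_torus: "topspace (quantum_torus L) = range (proj L)"
proof -
  have "istopology (\<lambda>U. U \<subseteq> range (proj L) \<and> open (proj L -` U))"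
    unfolding istopology_def by (auto simp: vimage_Union)
  then have "openin (quantum_torus L) U \<longleftrightarrow> U \<subseteq> range (proj L) \<and> open (proj L -` U)" for U
    unfolding quantum_torus_def by (simp add: topology_inverse')
  moreover have "proj L -` range (proj L) = UNIV" by auto
  ultimately show ?thesis
    by (intro subset_antisym openin_subset) (auto simp: topspace_def)
qed

lemma inj_on_quantum_torus: "inj_on quantum_torus {L. pseudolattice L}"
proof (rule inj_onI)
  fix L M assume "L \<in> {L. pseudolattice L}" "M \<in> {L. pseudolattice L}"
    and eq: "quantum_torus L = quantum_torus M"
  then have L: "pseudolattice L" and M: "pseudolattice M" by auto
  have "proj L 0 \<in> range (proj M)"
    using eq topspace_quantum_torus by (metis rangeI)
  then obtain x where x: "proj L 0 = proj M x" by blast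
  have "0 \<in> proj L 0"
    using pseudolattice_zero[OF L] by (simp add: proj_def)
  \<comment> \<open>The class \<open>proj M x\<close> contains 0, so it is \<open>M\<close>
    itself.\<close>
  then have "- x \<in> M" unfolding x by (auto simp: proj_def add_eq_0_iff)
  then have "proj M x = proj M 0"
    using proj_eq_iff[OF M] pseudolattice_minus[OF M, of "- x"] by simp
  with x show "L = M" by (simp add: proj_def)
qed

text \<open>An arbitrary representative is multiplied; the result does not depend on it once
  \<open>\<beta>\<close> maps \<open>L\<close> into \<open>M\<close>. The restriction makes equality
  of these maps a matter of their values on the torus alone.\<close>

definition mult_map :: "real set \<Rightarrow> real set \<Rightarrow> real \<Rightarrow> real set \<Rightarrow> real set" where
  "mult_map L M \<beta> = (\<lambda>z\<in>range (proj L). proj M (\<beta> * (SOME x. proj L x = z)))"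

lemma mult_map_proj:
  assumes "pseudolattice L" "pseudolattice M" "(\<lambda>l. \<beta> * l) ` L \<subseteq> M"
  shows "mult_map L M \<beta> (proj L x) = proj M (\<beta> * x)"
proof -
  have "proj L (SOME y. proj L y = proj L x) = proj L x" by (rule someI) (rule refl)
  then have "(SOME y. proj L y = proj L x) - x \<in> L"
    unfolding proj_eq_iff[OF assms(1)] .
  then have "\<beta> * ((SOME y. proj L y = proj L x) - x) \<in> M"
    using assms(3) by blast
  then have "proj M (\<beta> * (SOME y. proj L y = proj L x)) = proj M (\<beta> * x)"
    unfolding proj_eq_iff[OF assms(2)] by (simp add: right_diff_distrib)
  then show ?thesis by (simp add: mult_map_def)
qed

lemma extensional_mult_map: "mult_map L M \<beta> \<in> extensional (range (proj L))"
  by (simp add: mult_map_def)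

lemma mult_map_PiE: "mult_map L M \<beta> \<in> range (proj L) \<rightarrow>\<^sub>E range (proj M)"
  by (auto simp: mult_map_def)

text \<open>If two multipliers induce the same map, their difference multiplies every real into
  \<open>M\<close>. Were it nonzero, every real would lie in \<open>M\<close>.\<close>

lemma inj_on_mult_map:
  assumes "pseudolattice L" "pseudolattice M"
  shows "inj_on (mult_map L M) {\<beta>. (\<lambda>l. \<beta> * l) ` L \<subseteq> M}"
proof (rule inj_onI, rule ccontr)
  fix \<beta> \<gamma>
  assume \<beta>: "\<beta> \<in> {\<beta>. (\<lambda>l. \<beta> * l) ` L \<subseteq> M}" and \<gamma>: "\<gamma> \<in> {\<beta>. (\<lambda>l. \<beta> * l) ` L \<subseteq> M}"
    and eq: "mult_map L M \<beta> = mult_map L M \<gamma>" and "\<beta> \<noteq> \<gamma>"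
  have "proj M (\<beta> * x) = proj M (\<gamma> * x)" for x
    using mult_map_proj[OF assms, of \<beta> x] mult_map_proj[OF assms, of \<gamma> x] \<beta> \<gamma> eq by simp
  then have "\<beta> * x - \<gamma> * x \<in> M" for x
    by (simp add: proj_eq_iff[OF assms(2)])
  then have "(\<beta> - \<gamma>) * (y / (\<beta> - \<gamma>)) \<in> M" for y
    unfolding left_diff_distrib .
  then have "y \<in> M" for y
    using \<open>\<beta> \<noteq> \<gamma>\<close> by simp
  then show False using pseudolattice_neq_UNIV[OF assms(2)] by blast
qed


section \<open>Morphisms of quantum tori\<close>

context nonstandard
begin

lemma hproj_eq_iff:
  assumes "pseudolattice L"
  shows "hproj N L x = hproj N L y \<longleftrightarrow> (\<exists>l\<in>L. x = y + hyper N l)"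
proof
  assume "hproj N L x = hproj N L y"
  moreover have "x \<in> hproj N L x"
    using pseudolattice_zero[OF assms] by (force simp: hproj_def)
  ultimately show "\<exists>l\<in>L. x = y + hyper N l" by (auto simp: hproj_def)
next
  assume "\<exists>l\<in>L. x = y + hyper N l"
  then obtain l where l: "l \<in> L" "x = y + hyper N l" by blast
  have "x + hyper N k \<in> hproj N L y" if "k \<in> L" for k
    unfolding hproj_def l(2) using pseudolattice_add[OF assms l(1) that]
    by (auto intro!: image_eqI[of _ _ "l + k"] simp: hyper_add)
  moreover have "y + hyper N k \<in> hproj N L x" if "k \<in> L" for k
    unfolding hproj_def l(2) using pseudolattice_diff[OF assms that l(1)]
    by (auto intro!: image_eqI[of _ _ "k - l"] simp: hyper_diff)
  ultimately show "hproj N L x = hproj N L y"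
    by (auto simp: hproj_def)
qed

text \<open>Representatives of one class differ by some \<open>hyper N l\<close> with
  \<open>l \<in> L\<close>, so their standard parts differ by \<open>l\<close> and the
  \<open>THE\<close> in \<open>to_quantum\<close> is justified.\<close>

lemma to_quantum_hproj:
  assumes "pseudolattice L" "x \<in> nst N"
  shows "to_quantum N L (hproj N L x) = proj L (st N x)"
  unfolding to_quantum_def
proof (rule the_equality)
  show "\<exists>y\<in>nst N. hproj N L x = hproj N L y \<and> proj L (st N x) = proj L (st N y)"
    using assms(2) by blast
next
  fix z assume "\<exists>y\<in>nst N. hproj N L x = hproj N L y \<and> z = proj L (st N y)"
  then obtain y l where "y \<in> nst N" "z = proj L (st N y)" "l \<in> L" "x = y + hyper N l"
    using hproj_eq_iff[OF assms(1)] by blast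
  then show "z = proj L (st N x)"
    using assms(1) by (simp add: st_add proj_eq_iff pseudolattice_minus)
qed

text \<open>The third conclusion is exact, not just up to an infinitesimal. This is what makes the
  multiplier of an orientation-preserving map strictly positive.\<close>

lemma covering_hom_multiplier:
  assumes "pseudolattice L" "pseudolattice M" "covering_hom N L M \<phi>"
  obtains \<beta> where "\<And>x. x \<in> nst N \<Longrightarrow> st N (\<phi> x) = \<beta> * st N x"
    "\<And>l. l \<in> L \<Longrightarrow> \<beta> * l \<in> M" "\<And>l. l \<in> L \<Longrightarrow> \<phi> (hyper N l) = hyper N (\<beta> * l)"
proof -
  have add: "\<And>x y. \<phi> (x + y) = \<phi> x + \<phi> y"
    and \<phi>: "internal_fun N \<phi>" "\<phi> ` nst N \<subseteq> nst N"
    and L: "\<And>r s. r \<in> nst N \<Longrightarrow> s \<in> hproj N L r \<Longrightarrow> hproj N M (\<phi> s) = hproj N M (\<phi> r)"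
    using assms(3) by (auto simp: covering_hom_def)
  obtain \<beta> where \<beta>: "\<And>x. x \<in> nst N \<Longrightarrow> st N (\<phi> x) = \<beta> * st N x"
    by (rule st_internal_additive[OF \<phi> add]) blast
  have "\<phi> 0 = 0" using add[of 0 0] by simp
  have *: "\<beta> * l \<in> M \<and> \<phi> (hyper N l) = hyper N (\<beta> * l)" if "l \<in> L" for l
  proof -
    \<comment> \<open>\<open>hyper N l\<close> is in the class of 0, so its image is in the class of
      \<open>\<phi> 0 = 0\<close> and is therefore a standard \<open>hyper N m\<close>; taking
      standard parts gives \<open>m = \<beta> * l\<close>.\<close>
    have "hproj N M (\<phi> (hyper N l)) = hproj N M 0"
      using L[of 0 "hyper N l"] that \<open>\<phi> 0 = 0\<close> by (simp add: hproj_def)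
    then obtain m where "m \<in> M" "\<phi> (hyper N l) = hyper N m"
      unfolding hproj_eq_iff[OF assms(2)] by auto
    with \<beta>[of "hyper N l"] show ?thesis by simp
  qed
  show ?thesis by (rule that[of \<beta>]) (use \<beta> * in blast)+
qed

lemma covering_hom_times:
  assumes "pseudolattice L" "pseudolattice M" "(\<lambda>l. \<beta> * l) ` L \<subseteq> M"
  shows "covering_hom N L M (\<lambda>x. hyper N \<beta> * x)"
  unfolding covering_hom_def hproj_eq_iff[OF assms(2)]
proof (intro conjI ballI)
  fix r s assume "s \<in> hproj N L r"
  then obtain l where "l \<in> L" "s = r + hyper N l" by (auto simp: hproj_def)
  then show "\<exists>l\<in>M. hyper N \<beta> * s = hyper N \<beta> * r + hyper N l"
    using assms(3) by (auto simp: distrib_left hyper_mult intro!: bexI[of _ "\<beta> * l"])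
qed (auto simp: internal_times distrib_left nst_hyper_mult)

text \<open>The class \<open>P\<close> of covering maps and the set \<open>R\<close> of multipliers
  stay abstract, linked only by \<open>times\<close> and \<open>multiplier\<close>, so that the
  signed and the positive case share one proof.\<close>

lemma Hom_quantum_tori_cat:
  assumes times: "\<And>\<beta>. \<beta> \<in> R \<Longrightarrow> (\<lambda>x. hyper N \<beta> * x) \<in> P"
    and multiplier: "\<And>\<phi> \<beta> l. \<phi> \<in> P \<Longrightarrow> 0 < l \<Longrightarrow> \<phi> (hyper N l) = hyper N (\<beta> * l) \<Longrightarrow> \<beta> \<in> R"
    and L: "pseudolattice L" and M: "pseudolattice M"
  shows "Hom (quantum_tori_cat N P) (quantum_torus L) (quantum_torus M) =
    mult_map L M ` {\<beta> \<in> R. (\<lambda>l. \<beta> * l) ` L \<subseteq> M}"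
proof (intro subset_antisym subsetI)
  fix f assume f: "f \<in> Hom (quantum_tori_cat N P) (quantum_torus L) (quantum_torus M)"
  then have ext: "f \<in> range (proj L) \<rightarrow>\<^sub>E range (proj M)"
    by (simp add: quantum_tori_cat_def topspace_quantum_torus)
  obtain g where g: "g \<in> hyper_torus_homs N P L M"
    \<comment> \<open>A morphism comes with some pseudolattices presenting its source and target;
      injectivity of \<open>quantum_torus\<close> identifies them with \<open>L\<close> and
      \<open>M\<close>.\<close>
    and fg: "\<And>t. t \<in> hyper_torus N L \<Longrightarrow> to_quantum N M (g t) = f (to_quantum N L t)"
    using f L M by (auto simp: quantum_tori_cat_def inj_on_eq_iff[OF inj_on_quantum_torus])
  obtain \<phi> where "\<phi> \<in> P" and \<phi>: "covering_hom N L M \<phi>"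
    and g\<phi>: "\<And>x. x \<in> nst N \<Longrightarrow> g (hproj N L x) = hproj N M (\<phi> x)"
    using g by (auto simp: hyper_torus_homs_def)
  obtain \<beta> where \<beta>: "\<And>x. x \<in> nst N \<Longrightarrow> st N (\<phi> x) = \<beta> * st N x"
    "\<And>l. l \<in> L \<Longrightarrow> \<beta> * l \<in> M" "\<And>l. l \<in> L \<Longrightarrow> \<phi> (hyper N l) = hyper N (\<beta> * l)"
    by (rule covering_hom_multiplier[OF L M \<phi>]) blast
  have "\<beta> \<in> R"
    using pseudolattice_positive[OF L] multiplier[OF \<open>\<phi> \<in> P\<close>] \<beta>(3) by metis
  have LM: "(\<lambda>l. \<beta> * l) ` L \<subseteq> M" using \<beta>(2) by blast
  \<comment> \<open>Every class modulo \<open>L\<close> has a standard representative, so testing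
    \<open>f\<close> below the points \<open>hyper N r\<close> determines it.\<close>
  have "f (proj L r) = proj M (\<beta> * r)" for r
  proof -
    have "\<phi> (hyper N r) \<in> nst N" using \<phi> by (auto simp: covering_hom_def)
    then show ?thesis
      using fg[of "hproj N L (hyper N r)"] g\<phi>[of "hyper N r"] \<beta>(1)[of "hyper N r"]
      by (simp add: hyper_torus_def to_quantum_hproj L M)
  qed
  then have "f = mult_map L M \<beta>"
    using mult_map_proj[OF L M LM]
    by (intro PiE_ext[OF ext mult_map_PiE]) auto
  then show "f \<in> mult_map L M ` {\<beta> \<in> R. (\<lambda>l. \<beta> * l) ` L \<subseteq> M}"
    using \<open>\<beta> \<in> R\<close> LM by blast
next
  fix f assume "f \<in> mult_map L M ` {\<beta> \<in> R. (\<lambda>l. \<beta> * l) ` L \<subseteq> M}"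
  then obtain \<beta> where \<beta>: "\<beta> \<in> R" "(\<lambda>l. \<beta> * l) ` L \<subseteq> M" "f = mult_map L M \<beta>" by blast
  let ?\<phi> = "\<lambda>x. hyper N \<beta> * x"
  have \<phi>: "covering_hom N L M ?\<phi>" by (rule covering_hom_times[OF L M \<beta>(2)])
  \<comment> \<open>The lift multiplies a chosen near-standard representative;
    \<open>covering_hom\<close> makes the resulting class independent of the choice.\<close>
  define g where "g = (\<lambda>t\<in>hyper_torus N L. hproj N M (?\<phi> (SOME x. x \<in> nst N \<and> hproj N L x = t)))"
  have g: "g (hproj N L x) = hproj N M (?\<phi> x)" if "x \<in> nst N" for x
  proof -
    define y where "y = (SOME y. y \<in> nst N \<and> hproj N L y = hproj N L x)"
    have y: "y \<in> nst N \<and> hproj N L y = hproj N L x"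
      unfolding y_def by (rule someI[of _ x]) (use that in simp)
    then have "y \<in> hproj N L x"
      using hproj_eq_iff[OF L, of y x] by (auto simp: hproj_def)
    then have "hproj N M (?\<phi> y) = hproj N M (?\<phi> x)"
      using \<phi> that by (simp add: covering_hom_def)
    then show ?thesis
      using that by (simp add: g_def hyper_torus_def y_def)
  qed
  have "g \<in> hyper_torus_homs N P L M"
    unfolding hyper_torus_homs_def
  proof (intro CollectI conjI bexI[of _ ?\<phi>] ballI PiE_I)
    show "?\<phi> \<in> P" by (rule times[OF \<beta>(1)])
    show "g t \<in> hyper_torus N M" if "t \<in> hyper_torus N L" for t
      using that g by (auto simp: hyper_torus_def nst_hyper_mult)
    show "g t = undefined" if "t \<notin> hyper_torus N L" for t
      using that by (simp add: g_def)
  qed (simp_all add: \<phi> g)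
  moreover have "to_quantum N M (g t) = f (to_quantum N L t)" if "t \<in> hyper_torus N L" for t
    using that g by (auto simp: hyper_torus_def to_quantum_hproj L M nst_hyper_mult
        st_hyper_mult \<beta>(3) mult_map_proj[OF L M \<beta>(2)])
  ultimately show "f \<in> Hom (quantum_tori_cat N P) (quantum_torus L) (quantum_torus M)"
    using L M mult_map_PiE[of L M \<beta>]
    by (simp add: quantum_tori_cat_def topspace_quantum_torus \<beta>(3)) blast
qed

end


section \<open>Equivalence of categories\<close>

lemma is_iso_Ident: "category C \<Longrightarrow> a \<in> Obj C \<Longrightarrow> is_iso C a a (Ident C a)"
  unfolding category_def is_iso_def by metis

text \<open>\<open>F\<close> and \<open>K\<close> form an isomorphism of categories. Only
  \<open>D\<close> is assumed to be a category: all objects and morphisms of \<open>C\<close> are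
  images, so the axioms are carried over.\<close>

lemma equivalent_categories_if_isomorphic:
  fixes C :: "('o, 'm) cat" and D :: "('p, 'n) cat"
  assumes D: "category D"
    and inj: "inj_on F (Obj D)" and Obj: "Obj C = F ` Obj D"
    and K: "\<And>a b. a \<in> Obj D \<Longrightarrow> b \<in> Obj D \<Longrightarrow>
      bij_betw (K a b) (Hom D a b) (Hom C (F a) (F b))"
    and Ident: "\<And>a. a \<in> Obj D \<Longrightarrow> K a a (Ident D a) = Ident C (F a)"
    and Comp: "\<And>a b c f g. a \<in> Obj D \<Longrightarrow> b \<in> Obj D \<Longrightarrow> c \<in> Obj D \<Longrightarrow>
      f \<in> Hom D a b \<Longrightarrow> g \<in> Hom D b c \<Longrightarrow>
      K a c (Comp D a b c g f) = Comp C (F a) (F b) (F c) (K b c g) (K a b f)"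
  shows "equivalent_categories C D"
proof -
  have HomC: "Hom C (F a) (F b) = K a b ` Hom D a b" if "a \<in> Obj D" "b \<in> Obj D" for a b
    using K[OF that] by (simp add: bij_betw_def)
  have D_id: "\<And>a. a \<in> Obj D \<Longrightarrow> Ident D a \<in> Hom D a a"
    and D_comp: "\<And>a b c f g. a \<in> Obj D \<Longrightarrow> b \<in> Obj D \<Longrightarrow> c \<in> Obj D \<Longrightarrow>
      f \<in> Hom D a b \<Longrightarrow> g \<in> Hom D b c \<Longrightarrow> Comp D a b c g f \<in> Hom D a c"
    and D_unit: "\<And>a b f. a \<in> Obj D \<Longrightarrow> b \<in> Obj D \<Longrightarrow> f \<in> Hom D a b \<Longrightarrow>
        Comp D a a b f (Ident D a) = f \<and> Comp D a b b (Ident D b) f = f"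
    and D_assoc: "\<And>a b c d f g h. a \<in> Obj D \<Longrightarrow> b \<in> Obj D \<Longrightarrow> c \<in> Obj D \<Longrightarrow> d \<in> Obj D \<Longrightarrow>
      f \<in> Hom D a b \<Longrightarrow> g \<in> Hom D b c \<Longrightarrow> h \<in> Hom D c d \<Longrightarrow>
      Comp D a c d h (Comp D a b c g f) = Comp D a b d (Comp D b c d h g) f"
    using D unfolding category_def by blast+
  have C: "category C"
    unfolding category_def Obj
    by (auto simp: HomC Ident[symmetric] Comp[symmetric] D_id D_comp D_unit D_assoc)
  define G where "G = inv_into (Obj D) F"
  \<comment> \<open>Objects must be pulled back first, since the inverse of \<open>K\<close> depends
    on the pair of objects in \<open>D\<close>.\<close>
  define H where "H x y = inv_into (Hom D (G x) (G y)) (K (G x) (G y))" for x y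
  have G: "G (F a) = a" if "a \<in> Obj D" for a
    using that inj by (simp add: G_def)
  have H: "H (F a) (F b) (K a b f) = f" if "a \<in> Obj D" "b \<in> Obj D" "f \<in> Hom D a b" for a b f
    using that K by (simp add: H_def G bij_betw_def)
  have "is_functor C D (G, H)"
    unfolding is_functor_def Obj
    by (auto simp: HomC G H Ident[symmetric] Comp[symmetric] D_id D_comp)
  moreover have "is_functor D C (F, K)"
    unfolding is_functor_def Obj by (auto simp: HomC Ident Comp)
  moreover have "is_iso C (F a) (F a) (K a a (Ident D a))" if "a \<in> Obj D" for a
    using is_iso_Ident[OF C, of "F a"] that by (simp add: Obj Ident)
  \<comment> \<open>Both composites are the identity on objects and morphisms, so identity morphisms
    serve as natural isomorphisms.\<close>
  then have "nat_iso C C id_functor (comp_functor (F, K) (G, H)) (Ident C)"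
    unfolding nat_iso_def id_functor_def comp_functor_def
    by (auto simp: Obj HomC G H Comp[symmetric] D_id D_unit simp flip: Ident)
  moreover have "nat_iso D D (comp_functor (G, H) (F, K)) id_functor (Ident D)"
    unfolding nat_iso_def id_functor_def comp_functor_def
    using is_iso_Ident[OF D] by (auto simp: G H D_unit)
  ultimately show ?thesis
    unfolding equivalent_categories_def using C D by blast
qed

section \<open>Quantum tori versus multipliers\<close>

lemma category_multiplier_cat:
  assumes "1 \<in> R" "\<And>\<beta> \<gamma>. \<beta> \<in> R \<Longrightarrow> \<gamma> \<in> R \<Longrightarrow> \<gamma> * \<beta> \<in> R"
  shows "category (multiplier_cat R)"
  using assms by (auto simp: category_def multiplier_cat_def image_subset_iff mult.assoc)

lemma (in nonstandard) equivalent_quantum_tori_cat: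
  assumes one: "1 \<in> R" and mult: "\<And>\<beta> \<gamma>. \<beta> \<in> R \<Longrightarrow> \<gamma> \<in> R \<Longrightarrow> \<gamma> * \<beta> \<in> R"
    and times: "\<And>\<beta>. \<beta> \<in> R \<Longrightarrow> (\<lambda>x. hyper N \<beta> * x) \<in> P"
    and multiplier: "\<And>\<phi> \<beta> l. \<phi> \<in> P \<Longrightarrow> 0 < l \<Longrightarrow> \<phi> (hyper N l) = hyper N (\<beta> * l) \<Longrightarrow> \<beta> \<in> R"
  shows "equivalent_categories (quantum_tori_cat N P) (multiplier_cat R)"
proof (rule equivalent_categories_if_isomorphic[where F = quantum_torus and K = mult_map])
  show "category (multiplier_cat R)"
    using one mult by (rule category_multiplier_cat)
  show "inj_on quantum_torus (Obj (multiplier_cat R))"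
    using inj_on_quantum_torus by (simp add: multiplier_cat_def)
  show "Obj (quantum_tori_cat N P) = quantum_torus ` Obj (multiplier_cat R)"
    by (auto simp: multiplier_cat_def quantum_tori_cat_def)
next
  fix L M assume "L \<in> Obj (multiplier_cat R)" "M \<in> Obj (multiplier_cat R)"
  then have L: "pseudolattice L" and M: "pseudolattice M" by (auto simp: multiplier_cat_def)
  have "Hom (quantum_tori_cat N P) (quantum_torus L) (quantum_torus M) =
      mult_map L M ` {\<beta> \<in> R. (\<lambda>l. \<beta> * l) ` L \<subseteq> M}"
    using times multiplier L M by (rule Hom_quantum_tori_cat)
  moreover have "inj_on (mult_map L M) {\<beta> \<in> R. (\<lambda>l. \<beta> * l) ` L \<subseteq> M}"
    by (rule inj_on_subset[OF inj_on_mult_map[OF L M]]) blast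
  ultimately show "bij_betw (mult_map L M) (Hom (multiplier_cat R) L M)
      (Hom (quantum_tori_cat N P) (quantum_torus L) (quantum_torus M))"
    by (simp add: multiplier_cat_def bij_betw_def)
next
  fix L assume "L \<in> Obj (multiplier_cat R)"
  then have L: "pseudolattice L" by (simp add: multiplier_cat_def)
  show "mult_map L L (Ident (multiplier_cat R) L) =
      Ident (quantum_tori_cat N P) (quantum_torus L)"
    \<comment> \<open>Both sides are extensional on the same torus, so it suffices to compare them
      at the classes \<open>proj L x\<close>.\<close>
    by (rule extensionalityI[of _ "range (proj L)"])
      (auto simp: multiplier_cat_def quantum_tori_cat_def topspace_quantum_torus
        mult_map_proj[OF L L] extensional_mult_map)
next
  fix L M K \<beta> \<gamma>
  assume "L \<in> Obj (multiplier_cat R)" "M \<in> Obj (multiplier_cat R)" "K \<in> Obj (multiplier_cat R)"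
    "\<beta> \<in> Hom (multiplier_cat R) L M" "\<gamma> \<in> Hom (multiplier_cat R) M K"
  then have L: "pseudolattice L" and M: "pseudolattice M" and K: "pseudolattice K"
    and \<beta>: "(\<lambda>l. \<beta> * l) ` L \<subseteq> M" and \<gamma>: "(\<lambda>l. \<gamma> * l) ` M \<subseteq> K"
    by (auto simp: multiplier_cat_def)
  have \<gamma>\<beta>: "(\<lambda>l. \<gamma> * \<beta> * l) ` L \<subseteq> K"
    using \<beta> \<gamma> by (auto simp: image_subset_iff mult.assoc)
  show "mult_map L K (Comp (multiplier_cat R) L M K \<gamma> \<beta>) =
      Comp (quantum_tori_cat N P) (quantum_torus L) (quantum_torus M) (quantum_torus K)
        (mult_map M K \<gamma>) (mult_map L M \<beta>)"
    by (rule extensionalityI[of _ "range (proj L)"])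
      (auto simp: multiplier_cat_def quantum_tori_cat_def topspace_quantum_torus
        compose_eq mult_map_proj[OF L K \<gamma>\<beta>] mult_map_proj[OF M K \<gamma>] mult_map_proj[OF L M \<beta>]
        mult.assoc extensional_mult_map)
qed

theorem theoremA:
  fixes N :: "('u, 'h::linordered_field, 'v) ns_model"
  assumes "nonstandard_model N"
  shows "equivalent_categories (QT N) PL_signed \<and> equivalent_categories (QT_pos N) PL"
proof -
  interpret nonstandard N by unfold_locales (rule assms)
  have "equivalent_categories (QT N) PL_signed"
    unfolding QT_def PL_signed_def by (rule equivalent_quantum_tori_cat) auto
  moreover have "equivalent_categories (QT_pos N) PL"
    unfolding QT_pos_def PL_def
  proof (rule equivalent_quantum_tori_cat)
    fix \<phi> :: "'h \<Rightarrow> 'h" and \<beta> l :: real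
    assume \<phi>: "\<phi> \<in> {\<phi>. \<forall>x>0. 0 < \<phi> x}" and "0 < l" and eq: "\<phi> (hyper N l) = hyper N (\<beta> * l)"
    \<comment> \<open>Since \<open>eq\<close> is exact, \<open>hyper N (\<beta> * l)\<close> itself
      is positive, which excludes \<open>\<beta> = 0\<close>.\<close>
    have "0 < \<phi> (hyper N l)" using \<phi> \<open>0 < l\<close> by simp
    then show "\<beta> \<in> {0<..}" using \<open>0 < l\<close> by (simp add: eq zero_less_mult_iff)
  qed auto
  ultimately show ?thesis ..
qed

end
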